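(* For $a\in\mathbb{R}$ and integers $n\ge 1$ with $n+a>0$, define $w_n(a)\in\mathbb{R}$ by $$n!=\frac{n^n}{e^n}\sqrt{2\pi n}\,\exp\biggl(\frac{1}{12}\psi'(n+a)\biggr)\exp\bigl(w_n(a)\bigr).$$ Then, as $n\to\infty$, the asymptotic formula $$n!\sim\frac{n^n}{e^n}\sqrt{2\pi n}\,\exp\biggl(\frac{1}{12}\psi'\biggl(n+\frac12\biggr)\biggr)$$ holds, i.e. $\lim_{n\to\infty}w_n\bigl(\tfrac12\bigr)=0$, and it is the most accurate one among all approximations of the form $$n!\sim\frac{n^n}{e^n}\sqrt{2\pi n}\,\exp\biggl(\frac{1}{12}\psi'(n+a)\biggr),\qquad a\in\mathbb{R},$$ in the sense that for every real $a\neq\frac12$ one has $w_n(a)\ne 0$ for all sufficiently large $n$ and $$\lim_{n\to\infty}\frac{w_n\bigl(\tfrac12\bigr)}{w_n(a)}=0.$$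
   Context: $\Gamma$ is Euler's gamma function, $\Gamma(x)=\int_0^\infty t^{x-1}e^{-t}\,dt$ for $x>0$; $\psi(x)=\frac{d}{dx}\ln\Gamma(x)=\Gamma'(x)/\Gamma(x)$ is the di-gamma function, and its derivative $\psi'(x)$, $x>0$, is the tri-gamma function. The relation $A_n\sim B_n$ as $n\to\infty$ means $A_n/B_n\to1$. *)

theory Defs
  imports "HOL-Analysis.Analysis" "HOL-Library.Landau_Symbols"
begin

definition trigamma_approx :: "real \<Rightarrow> nat \<Rightarrow> real" where
  "trigamma_approx a n =
     real n ^ n / exp (real n) * sqrt (2 * pi * real n) * exp (1 / 12 * Polygamma 1 (real n + a))"

text \<open>
  On the positive reals \<^term>\<open>Polygamma 0\<close> and \<^term>\<open>Polygamma 1\<close> are the first and second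
  derivative of \<open>ln \<circ> Gamma\<close>, that is, the di-gamma and tri-gamma functions.
\<close>

lemma deriv_ln_Gamma_real:
  fixes x :: real
  assumes "x > 0"
  shows "((\<lambda>t. ln (Gamma t)) has_real_derivative Polygamma 0 x) (at x)"
    and "(Polygamma 0 has_real_derivative Polygamma 1 x) (at x)"
proof -
  have x: "x \<notin> \<int>\<^sub>\<le>\<^sub>0"
    using assms by (auto elim!: nonpos_Ints_cases)
  have "(Gamma has_real_derivative Gamma x * Digamma x) (at x)"
    by (rule has_field_derivative_Gamma [OF x])
  then show "((\<lambda>t. ln (Gamma t)) has_real_derivative Polygamma 0 x) (at x)"
    using Gamma_real_pos [OF assms] x by (auto intro!: derivative_eq_intros)
  show "(Polygamma 0 has_real_derivative Polygamma 1 x) (at x)"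
    using has_field_derivative_Polygamma [OF x, of 0] by simp
qed

text \<open>
  The defining equation of the error term has exactly one solution, so assuming it for a
  function \<open>w\<close> determines \<open>w n a\<close> whenever \<open>n \<ge> 1\<close> and \<open>n + a > 0\<close>.
\<close>

lemma ex1_trigamma_error:
  assumes "n \<ge> 1"
  shows "\<exists>!w. (fact n :: real) = trigamma_approx a n * exp w"
proof -
  have pos: "trigamma_approx a n > 0"
    using assms by (simp add: trigamma_approx_def)
  show ?thesis
  proof (rule ex1I)
    show "(fact n :: real) = trigamma_approx a n * exp (ln (fact n / trigamma_approx a n))"
      using pos by simp
  next
    fix w assume "(fact n :: real) = trigamma_approx a n * exp w"
    then show "w = ln (fact n / trigamma_approx a n)"
      using pos by simp
  qed
qed

end

theory Submission
  imports Defs "HOL-Real_Asymp.Real_Asymp"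
begin

text \<open>
  Let \<open>s\<^sub>n\<close> be the logarithmic error of Stirling's formula, so that \<open>w\<^sub>n(a) = s\<^sub>n - \<psi>'(n + a) / 12\<close>.
  All these sequences tend to \<open>0\<close> and have elementary differences: \<open>s\<^sub>n - s\<^sub>n\<^sub>+\<^sub>1\<close> is
  \<open>(n + 1/2) ln (1 + 1/n) - 1\<close> and \<open>\<psi>'(x) - \<psi>'(x + 1) = 1 / x\<^sup>2\<close>. By the Stolz-Cesaro theorem
  for the \<open>0/0\<close> case, \<open>n\<^sup>2 w\<^sub>n(1/2) \<rightarrow> 0\<close> and \<open>n\<^sup>2 (w\<^sub>n(a) - w\<^sub>n(1/2)) \<rightarrow> (a - 1/2) / 12\<close>.
\<close>

section \<open>The discrete l'Hospital rule for 0/0\<close>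

text \<open>This turns an inequality between consecutive differences into one between the sequences
  themselves.\<close>

lemma eventually_nonneg_if_decreasing_to_0:
  fixes h :: "nat \<Rightarrow> real"
  assumes lim: "h \<longlonglongrightarrow> 0" and dec: "\<forall>\<^sub>F n in sequentially. h (Suc n) \<le> h n"
  shows "\<forall>\<^sub>F n in sequentially. h n \<ge> 0"
proof -
  obtain N where N: "\<And>n. n \<ge> N \<Longrightarrow> h (Suc n) \<le> h n"
    using dec by (auto simp: eventually_sequentially)
  have "decseq (\<lambda>n. h (n + N))"
    by (rule decseq_SucI) (use N in auto)
  then have "h (n + N) \<ge> 0" for n
    using LIMSEQ_ignore_initial_segment[OF lim, of N] decseq_ge by blast
  then show ?thesis
    unfolding eventually_sequentially by (metis le_add_diff_inverse2)
qed

text \<open>Since the difference quotients are eventually within \<open>e / 2\<close> of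
  \<open>L\<close>, the null sequences \<open>e / 2 * g n - (f n - L * g n)\<close> and
  \<open>e / 2 * g n + (f n - L * g n)\<close> eventually decrease. Hence they are eventually
  nonnegative, and dividing by \<open>g n\<close> gives the limit.\<close>

lemma stolz_cesaro_zero:
  fixes f g :: "nat \<Rightarrow> real"
  assumes f: "f \<longlonglongrightarrow> 0" and g: "g \<longlonglongrightarrow> 0"
    and pos: "\<forall>\<^sub>F n in sequentially. g n > 0"
    and dec: "\<forall>\<^sub>F n in sequentially. g (Suc n) < g n"
    and lim: "(\<lambda>n. (f n - f (Suc n)) / (g n - g (Suc n))) \<longlonglongrightarrow> L"
  shows "(\<lambda>n. f n / g n) \<longlonglongrightarrow> L"
proof (rule tendstoI)
  fix e :: real assume e: "e > 0"
  have ev: "\<forall>\<^sub>F n in sequentially. \<bar>(f n - f (Suc n)) / (g n - g (Suc n)) - L\<bar> < e / 2"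
    using tendstoD[OF lim, of "e / 2"] e by (simp add: dist_real_def)
  \<comment> \<open>The sign \<open>c\<close> treats both halves of the bound on the absolute value
    at once.\<close>
  have bound: "\<forall>\<^sub>F n in sequentially. c * (f n - L * g n) \<le> e / 2 * g n" if c: "c = 1 \<or> c = -1" for c
  proof -
    have "(\<lambda>n. e / 2 * g n - c * (f n - L * g n)) \<longlonglongrightarrow> e / 2 * 0 - c * (0 - L * 0)"
      by (intro tendsto_intros f g)
    then have "(\<lambda>n. e / 2 * g n - c * (f n - L * g n)) \<longlonglongrightarrow> 0"
      by simp
    moreover have "\<forall>\<^sub>F n in sequentially.
        e / 2 * g (Suc n) - c * (f (Suc n) - L * g (Suc n)) \<le> e / 2 * g n - c * (f n - L * g n)"
      using ev dec
    proof eventually_elim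
      case (elim n)
      let ?D = "g n - g (Suc n)" and ?F = "f n - f (Suc n)"
      have D: "?D > 0"
        using elim by simp
      have "c * (?F / ?D - L) \<le> \<bar>?F / ?D - L\<bar>"
        using c by (elim disjE) simp_all
      then have "c * (?F / ?D - L) \<le> e / 2"
        using elim(1) by linarith
      then have "c * (?F / ?D - L) * ?D \<le> e / 2 * ?D"
        using D by (intro mult_right_mono) auto
      also have "c * (?F / ?D - L) * ?D = c * (?F / ?D * ?D - L * ?D)"
        by (simp only: left_diff_distrib mult.assoc)
      also have "?F / ?D * ?D = ?F"
        using D by simp
      finally show ?case
        by (simp add: algebra_simps)
    qed
    ultimately have "\<forall>\<^sub>F n in sequentially. e / 2 * g n - c * (f n - L * g n) \<ge> 0"
      by (rule eventually_nonneg_if_decreasing_to_0)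
    then show ?thesis
      by eventually_elim simp
  qed
  show "\<forall>\<^sub>F n in sequentially. dist (f n / g n) L < e"
    using bound[of 1, simplified] bound[of "-1", simplified] pos
  proof eventually_elim
    case (elim n)
    have "\<bar>f n - L * g n\<bar> \<le> e / 2 * g n"
      using elim by linarith
    also have "\<dots> < e * g n"
      using e elim by simp
    finally have "\<bar>f n - L * g n\<bar> / g n < e"
      using elim by (simp add: divide_less_eq)
    also have "\<bar>f n - L * g n\<bar> / g n = \<bar>(f n - L * g n) / g n\<bar>"
      using elim by simp
    also have "(f n - L * g n) / g n = f n / g n - L"
      using elim by (simp add: diff_divide_distrib)
    finally show ?case
      by (simp add: dist_real_def)
  qed
qed

section \<open>Recurrence and decay of the tri-gamma function\<close>

lemma Trigamma_plus1:
  fixes x :: real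
  assumes "x > 0"
  shows "Polygamma 1 x - Polygamma 1 (x + 1) = 1 / x ^ 2"
  using Polygamma_plus1[of x 1] assms by (simp add: power2_eq_square)

text \<open>The recurrence exhibits the values as tails of the convergent series psi'(z) = sum of 1
  / (z + k)^2 over k.\<close>

lemma Trigamma_shift_tendsto_0: "(\<lambda>n. Polygamma 1 (real n + a)) \<longlonglongrightarrow> 0"
proof -
  \<comment> \<open>Starting at \<open>N\<close> makes the argument positive even when
    \<open>a\<close> is negative.\<close>
  obtain N where N: "real N > - a"
    using reals_Archimedean2 by blast
  define z where "z = real N + a"
  have z: "z > 0"
    using N by (simp add: z_def)
  have "(\<lambda>m. \<Sum>k<m. 1 / (z + real k) ^ 2) \<longlonglongrightarrow> Polygamma 1 z"
    using Polygamma_LIMSEQ[of z 1] z by (simp add: sums_def power2_eq_square inverse_eq_divide)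
  then have "(\<lambda>m. Polygamma 1 z - (\<Sum>k<m. 1 / (z + real k) ^ 2)) \<longlonglongrightarrow> Polygamma 1 z - Polygamma 1 z"
    by (intro tendsto_intros)
  moreover have "Polygamma 1 z - (\<Sum>k<m. 1 / (z + real k) ^ 2) = Polygamma 1 (real (m + N) + a)" for m
  proof -
    have "\<forall>k<m. z \<noteq> - real k"
      using z by auto
    from Polygamma_plus_of_nat[OF this, of 1] show ?thesis
      by (simp add: z_def add_ac power2_eq_square)
  qed
  ultimately have "(\<lambda>m. Polygamma 1 (real (m + N) + a)) \<longlonglongrightarrow> 0"
    by simp
  then show ?thesis
    by (rule LIMSEQ_offset)
qed

section \<open>Stirling's formula\<close>

definition stirling_error :: "nat \<Rightarrow> real" where
  "stirling_error n = ln (fact n) - (real n * ln (real n) - real n + ln (2 * pi * real n) / 2)"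

lemma stirling_error_diff:
  assumes "n \<ge> 1"
  shows "stirling_error n - stirling_error (Suc n) =
    (real n + 1 / 2) * ln (1 + 1 / real n) - 1"
proof -
  have "ln (fact (Suc n) :: real) = ln (real n + 1) + ln (fact n)"
    by (simp add: ln_mult add_ac)
  moreover have "ln (1 + 1 / real n) = ln (real n + 1) - ln (real n)"
    using assms ln_div[of "real n + 1" "real n"] by (simp add: add_divide_distrib)
  ultimately show ?thesis
    using assms by (simp add: stirling_error_def ln_mult add_ac) (simp add: field_simps)
qed

text \<open>The summand 1/2 in n + 1/2 cancels the 1/n term in the expansion of the difference,
  which is therefore of order 1/n^2 and summable. The partial sums telescope.\<close>

lemma stirling_error_convergent: "convergent stirling_error"
proof -
  have "(\<lambda>n. (real n + 1 / 2) * ln (1 + 1 / real n) - 1) \<in> O(\<lambda>n. 1 / real n ^ 2)"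
    by real_asymp
  also have "?this \<longleftrightarrow> (\<lambda>n. stirling_error n - stirling_error (Suc n)) \<in> O(\<lambda>n. 1 / real n ^ 2)"
    by (intro landau_o.big.in_cong eventually_mono[OF eventually_ge_at_top[of 1]])
       (simp add: stirling_error_diff)
  finally have bigo: "(\<lambda>n. stirling_error n - stirling_error (Suc n)) \<in> O(\<lambda>n. 1 / real n ^ 2)" .
  have "summable (\<lambda>n. norm (1 / real n ^ 2))"
    using inverse_power_summable[of 2, where 'a = real] by (simp add: inverse_eq_divide)
  from summable_comparison_test_bigo[OF this bigo]
  have "convergent (\<lambda>m. \<Sum>n<m. stirling_error n - stirling_error (Suc n))"
    by (simp add: summable_iff_convergent)
  then have "convergent (\<lambda>m. stirling_error 0 - stirling_error m)"
    by (simp add: sum_lessThan_telescope')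
  from convergent_diff[OF convergent_const this, of "stirling_error 0"] show ?thesis
    by simp
qed

text \<open>The constant in Stirling's formula comes from the value \<open>\<Gamma>(1/2) = \<surd>\<pi>\<close>.\<close>

lemma stirling_error_double:
  assumes "n \<ge> 1"
  shows "2 * stirling_error n - stirling_error (2 * n) =
    ln (Gamma_series' (1 / 2) n) - ln pi / 2"
proof -
  have n: "real n > 0"
    using assms by simp
  have poch: "pochhammer (1 / 2 :: real) n > 0"
    by (rule pochhammer_pos) simp
  have "(fact n :: real) = real n * fact (n - 1)"
    using assms by (simp add: fact_reduce)
  then have fact_n: "ln (fact n :: real) = ln (real n) + ln (fact (n - 1))"
    using n by (simp add: ln_mult)
  \<comment> \<open>This is the duplication formula (2n)! = 4^n (1/2)_n n!, with (1/2)_n the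
    Pochhammer symbol. It brings in the denominator of the product whose limit is
    Gamma(1/2).\<close>
  have fact_2n: "ln (fact (2 * n) :: real) = 2 * real n * ln 2 + ln (pochhammer (1 / 2) n) + ln (fact n)"
    using poch by (simp add: fact_double ln_mult ln_realpow)
  have gam: "ln (Gamma_series' (1 / 2 :: real) n) =
      ln (fact (n - 1)) + ln (real n) / 2 - ln (pochhammer (1 / 2) n)"
    using poch by (simp add: Gamma_series'_def ln_div ln_mult)
  have "ln (2 * pi * real (2 * n)) = 2 * ln 2 + ln pi + ln (real n)"
    using n ln_realpow[of 2 2] by (simp add: ln_mult)
  with n show ?thesis
    unfolding gam stirling_error_def fact_2n
    by (simp add: fact_n ln_mult) (simp add: field_simps)
qed

text \<open>If \<open>L\<close> is the limit, the doubled indices give 2L - L = ln Gamma(1/2) - (ln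
  pi)/2, which is 0.\<close>

theorem stirling_error_tendsto_0: "stirling_error \<longlonglongrightarrow> 0"
proof -
  obtain L where L: "stirling_error \<longlonglongrightarrow> L"
    using stirling_error_convergent by (auto simp: convergent_def)
  have "(\<lambda>n. stirling_error (2 * n)) \<longlonglongrightarrow> L"
    using LIMSEQ_subseq_LIMSEQ[OF L, of "\<lambda>n. 2 * n"] by (simp add: strict_mono_def o_def)
  then have "(\<lambda>n. 2 * stirling_error n - stirling_error (2 * n)) \<longlonglongrightarrow> 2 * L - L"
    by (intro tendsto_intros L)
  moreover have "(\<lambda>n. ln (Gamma_series' (1 / 2) n) - ln pi / 2) \<longlonglongrightarrow> ln (Gamma (1 / 2)) - ln pi / 2"
    by (intro tendsto_intros Gamma_series'_LIMSEQ) (simp add: Gamma_one_half_real)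
  then have "(\<lambda>n. 2 * stirling_error n - stirling_error (2 * n)) \<longlonglongrightarrow> ln (Gamma (1 / 2)) - ln pi / 2"
    by (rule Lim_transform_eventually)
       (auto intro!: eventually_mono[OF eventually_ge_at_top[of 1]] simp: stirling_error_double)
  ultimately have "2 * L - L = ln (Gamma (1 / 2)) - ln pi / 2"
    by (rule LIMSEQ_unique)
  then have "L = 0"
    by (simp add: Gamma_one_half_real ln_sqrt)
  with L show ?thesis
    by simp
qed

section \<open>Asymptotics at scale 1/n^2\<close>

text \<open>Here the shift 1/2 matters: (n + 1/2) ln (1 + 1/n) - 1 and 1 / (12 (n + 1/2)^2) both
  expand as 1/(12 n^2) - 1/(12 n^3) + O(1/n^4). Their difference is negligible against 1/n^2 - 1/(n
  + 1)^2, which behaves like 2/n^3.\<close>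

lemma trigamma_half_error_square_tendsto_0:
  "(\<lambda>n. (stirling_error n - Polygamma 1 (real n + 1 / 2) / 12) / (1 / real n ^ 2)) \<longlonglongrightarrow> 0"
proof (rule stolz_cesaro_zero)
  show "(\<lambda>n. stirling_error n - Polygamma 1 (real n + 1 / 2) / 12) \<longlonglongrightarrow> 0"
    using tendsto_diff[OF stirling_error_tendsto_0
        tendsto_divide[OF Trigamma_shift_tendsto_0 tendsto_const, of 12]] by simp
  show "(\<lambda>n. 1 / real n ^ 2) \<longlonglongrightarrow> 0" "\<forall>\<^sub>F n in sequentially. 1 / real n ^ 2 > 0"
    "\<forall>\<^sub>F n in sequentially. 1 / real (Suc n) ^ 2 < 1 / real n ^ 2"
    by real_asymp+
  have "(\<lambda>n. ((real n + 1 / 2) * ln (1 + 1 / real n) - 1 - 1 / (real n + 1 / 2) ^ 2 / 12) /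
      (1 / real n ^ 2 - 1 / (real n + 1) ^ 2)) \<longlonglongrightarrow> 0"
    by real_asymp
  then show "(\<lambda>n. (stirling_error n - Polygamma 1 (real n + 1 / 2) / 12 -
      (stirling_error (Suc n) - Polygamma 1 (real (Suc n) + 1 / 2) / 12)) /
      (1 / real n ^ 2 - 1 / real (Suc n) ^ 2)) \<longlonglongrightarrow> 0"
  proof (rule Lim_transform_eventually)
    show "\<forall>\<^sub>F n in sequentially.
      ((real n + 1 / 2) * ln (1 + 1 / real n) - 1 - 1 / (real n + 1 / 2) ^ 2 / 12) /
        (1 / real n ^ 2 - 1 / (real n + 1) ^ 2) =
      (stirling_error n - Polygamma 1 (real n + 1 / 2) / 12 -
        (stirling_error (Suc n) - Polygamma 1 (real (Suc n) + 1 / 2) / 12)) /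
        (1 / real n ^ 2 - 1 / real (Suc n) ^ 2)"
      using eventually_ge_at_top[of 1]
    proof eventually_elim
      case (elim n)
      show ?case
        unfolding stirling_error_diff[OF elim, symmetric]
        by (subst Trigamma_plus1[symmetric]) (simp_all add: add_ac diff_divide_distrib)
    qed
  qed
qed

lemma Trigamma_diff_square_tendsto:
  "(\<lambda>n. (Polygamma 1 (real n + 1 / 2) - Polygamma 1 (real n + a)) / (1 / real n ^ 2)) \<longlonglongrightarrow> a - 1 / 2"
proof (rule stolz_cesaro_zero)
  show "(\<lambda>n. Polygamma 1 (real n + 1 / 2) - Polygamma 1 (real n + a)) \<longlonglongrightarrow> 0"
    using tendsto_diff[OF Trigamma_shift_tendsto_0 Trigamma_shift_tendsto_0] by simp
  show "(\<lambda>n. 1 / real n ^ 2) \<longlonglongrightarrow> 0" "\<forall>\<^sub>F n in sequentially. 1 / real n ^ 2 > 0"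
    "\<forall>\<^sub>F n in sequentially. 1 / real (Suc n) ^ 2 < 1 / real n ^ 2"
    by real_asymp+
  have pos: "\<forall>\<^sub>F n in sequentially. real n + a > 0"
    by real_asymp
  \<comment> \<open>The factor \<open>a - 1 / 2\<close>, of unknown sign and possibly zero, is split
    off. The remaining numerator behaves like 2/n^3 for every \<open>a\<close>, just as the
    denominator does.\<close>
  have "(\<lambda>n. (2 * real n + a + 1 / 2) / ((real n + 1 / 2) ^ 2 * (real n + a) ^ 2) /
      (1 / real n ^ 2 - 1 / (real n + 1) ^ 2)) \<longlonglongrightarrow> 1"
    by real_asymp
  from tendsto_mult[OF tendsto_const[of "a - 1 / 2"] this]
  have "(\<lambda>n. (a - 1 / 2) * ((2 * real n + a + 1 / 2) / ((real n + 1 / 2) ^ 2 * (real n + a) ^ 2) /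
      (1 / real n ^ 2 - 1 / (real n + 1) ^ 2))) \<longlonglongrightarrow> a - 1 / 2"
    by simp
  then have "(\<lambda>n. (1 / (real n + 1 / 2) ^ 2 - 1 / (real n + a) ^ 2) /
      (1 / real n ^ 2 - 1 / (real n + 1) ^ 2)) \<longlonglongrightarrow> a - 1 / 2"
  proof (rule Lim_transform_eventually)
    show "\<forall>\<^sub>F n in sequentially.
      (a - 1 / 2) * ((2 * real n + a + 1 / 2) / ((real n + 1 / 2) ^ 2 * (real n + a) ^ 2) /
        (1 / real n ^ 2 - 1 / (real n + 1) ^ 2)) =
      (1 / (real n + 1 / 2) ^ 2 - 1 / (real n + a) ^ 2) / (1 / real n ^ 2 - 1 / (real n + 1) ^ 2)"
      using pos
    proof eventually_elim
      case (elim n)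
      have "1 / x ^ 2 - 1 / y ^ 2 = (y - x) * ((x + y) / (x ^ 2 * y ^ 2))"
        if "x > 0" "y > 0" for x y :: real
        using that by (simp add: field_simps power2_eq_square)
      from this[of "real n + 1 / 2" "real n + a"] elim show ?case
        by (simp add: add_ac)
    qed
  qed
  then show "(\<lambda>n. (Polygamma 1 (real n + 1 / 2) - Polygamma 1 (real n + a) -
      (Polygamma 1 (real (Suc n) + 1 / 2) - Polygamma 1 (real (Suc n) + a))) /
      (1 / real n ^ 2 - 1 / real (Suc n) ^ 2)) \<longlonglongrightarrow> a - 1 / 2"
  proof (rule Lim_transform_eventually)
    from pos show "\<forall>\<^sub>F n in sequentially.
      (1 / (real n + 1 / 2) ^ 2 - 1 / (real n + a) ^ 2) / (1 / real n ^ 2 - 1 / (real n + 1) ^ 2) =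
      (Polygamma 1 (real n + 1 / 2) - Polygamma 1 (real n + a) -
        (Polygamma 1 (real (Suc n) + 1 / 2) - Polygamma 1 (real (Suc n) + a))) /
        (1 / real n ^ 2 - 1 / real (Suc n) ^ 2)"
    proof eventually_elim
      case (elim n)
      show ?case
        using Trigamma_plus1[of "real n + 1 / 2", symmetric] Trigamma_plus1[OF elim, symmetric]
        by (simp add: add_ac)
    qed
  qed
qed

section \<open>Comparison of the error terms\<close>

lemma trigamma_error_eq:
  assumes "n \<ge> 1" and "(fact n :: real) = trigamma_approx a n * exp v"
  shows "v = stirling_error n - Polygamma 1 (real n + a) / 12"
proof -
  have "ln (fact n) = ln (trigamma_approx a n * exp v)"
    using assms(2) by simp
  also have "\<dots> = real n * ln (real n) - real n + ln (2 * pi * real n) / 2 +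
      Polygamma 1 (real n + a) / 12 + v"
    using assms(1) by (simp add: trigamma_approx_def ln_mult ln_div ln_realpow ln_sqrt)
  finally show ?thesis
    by (simp add: stirling_error_def)
qed

theorem theorem2p1:
  fixes w :: "nat \<Rightarrow> real \<Rightarrow> real"
  assumes w: "\<And>n a. n \<ge> 1 \<Longrightarrow> real n + a > 0 \<Longrightarrow>
                (fact n :: real) = trigamma_approx a n * exp (w n a)"
  shows "(\<lambda>n. fact n :: real) \<sim>[sequentially] trigamma_approx (1/2) \<and>
         (\<lambda>n. w n (1/2)) \<longlonglongrightarrow> 0 \<and>
         (\<forall>a. a \<noteq> 1/2 \<longrightarrow>
            (\<forall>\<^sub>F n in sequentially. w n a \<noteq> 0) \<and>
            (\<lambda>n. w n (1/2) / w n a) \<longlonglongrightarrow> 0)"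
proof (intro conjI allI impI)
  \<comment> \<open>The defining equation is available only for n + a > 0, so a negative
    \<open>a\<close> excludes finitely many n.\<close>
  have w_eq: "\<forall>\<^sub>F n in sequentially. w n a = stirling_error n - Polygamma 1 (real n + a) / 12" for a
  proof -
    have "\<forall>\<^sub>F n in sequentially. real n + a > 0"
      by real_asymp
    with eventually_ge_at_top[of 1] show ?thesis
      by eventually_elim (rule trigamma_error_eq, simp, rule w, simp_all)
  qed
  have "(\<lambda>n. stirling_error n - Polygamma 1 (real n + 1 / 2) / 12) \<longlonglongrightarrow> 0"
    using tendsto_diff[OF stirling_error_tendsto_0
        tendsto_divide[OF Trigamma_shift_tendsto_0 tendsto_const, of 12]] by simp
  then show w0: "(\<lambda>n. w n (1/2)) \<longlonglongrightarrow> 0"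
    using tendsto_cong[OF w_eq[of "1/2"]] by simp
  have "(\<lambda>n. exp (w n (1/2))) \<longlonglongrightarrow> 1"
    using tendsto_exp[OF w0] by simp
  moreover have "\<forall>\<^sub>F n in sequentially.
      exp (w n (1/2)) = (fact n :: real) / trigamma_approx (1/2) n"
    using eventually_ge_at_top[of 1]
  proof eventually_elim
    case (elim n)
    then have "trigamma_approx (1/2) n > 0"
      by (simp add: trigamma_approx_def)
    then show ?case
      using w[of n "1/2"] elim by simp
  qed
  ultimately have "(\<lambda>n. (fact n :: real) / trigamma_approx (1/2) n) \<longlonglongrightarrow> 1"
    by (rule Lim_transform_eventually)
  then show "(\<lambda>n. fact n :: real) \<sim>[sequentially] trigamma_approx (1/2)"
    by (rule asymp_equivI')
  fix a :: real assume a: "a \<noteq> 1/2"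
  have half: "(\<lambda>n. w n (1/2) / (1 / real n ^ 2)) \<longlonglongrightarrow> 0"
    using trigamma_half_error_square_tendsto_0
    by (rule Lim_transform_eventually) (use w_eq[of "1/2"] in eventually_elim, simp)
  \<comment> \<open>This splits w_n(a) as w_n(1/2) + (psi'(n + 1/2) - psi'(n + a)) / 12; only the
    second part contributes at order 1/n^2.\<close>
  have "(\<lambda>n. (stirling_error n - Polygamma 1 (real n + 1 / 2) / 12) / (1 / real n ^ 2) +
      (Polygamma 1 (real n + 1 / 2) - Polygamma 1 (real n + a)) / (1 / real n ^ 2) / 12)
      \<longlonglongrightarrow> 0 + (a - 1 / 2) / 12"
    by (intro tendsto_intros trigamma_half_error_square_tendsto_0 Trigamma_diff_square_tendsto) simp
  then have lim: "(\<lambda>n. w n a / (1 / real n ^ 2)) \<longlonglongrightarrow> 0 + (a - 1 / 2) / 12"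
    by (rule Lim_transform_eventually)
       (use w_eq[of a] in \<open>eventually_elim, simp only:, simp add: field_simps\<close>)
  \<comment> \<open>The nonzero limit of n^2 w_n(a) yields both remaining claims: w_n(a) is
    eventually nonzero, and the limit of n^2 w_n(1/2) may be divided by it.\<close>
  have nz: "0 + (a - 1 / 2) / 12 \<noteq> 0"
    using a by simp
  show "\<forall>\<^sub>F n in sequentially. w n a \<noteq> 0"
    using tendsto_imp_eventually_ne[OF lim nz] by eventually_elim auto
  have "(\<lambda>n. (w n (1/2) / (1 / real n ^ 2)) / (w n a / (1 / real n ^ 2))) \<longlonglongrightarrow>
      0 / (0 + (a - 1 / 2) / 12)"
    by (rule tendsto_divide[OF half lim nz])
  then have "(\<lambda>n. (w n (1/2) / (1 / real n ^ 2)) / (w n a / (1 / real n ^ 2))) \<longlonglongrightarrow> 0"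
    by simp
  then show "(\<lambda>n. w n (1/2) / w n a) \<longlonglongrightarrow> 0"
    by (rule Lim_transform_eventually)
       (use eventually_ge_at_top[of 1] in eventually_elim, simp)
qed

end
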